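(* Let $\mathrm{a}$ be the arcsine distribution on $(-1,1)$. There does not exist $\lambda\in\mathcal{P}_{+}$ such that $\mathrm{a}=\lambda\boxtimes\mathrm{w}$.
   Context: $\mathrm{a}(\mathrm{d}x)=\frac{1}{\pi\sqrt{1-x^2}}1_{(-1,1)}(x)\mathrm{d}x$ and $\mathrm{w}(\mathrm{d}x)=\frac{1}{2\pi}\sqrt{4-x^2}\,1_{(-2,2)}(x)\mathrm{d}x$ (Wigner measure). $\mathcal{P}_+$ is the set of Borel probability measures supported in $\mathbb{R}_+=[0,\infty)$; $\mathcal{P}_s$ is the set of symmetric Borel probability measures on $\mathbb{R}$. Let $\Psi_\mu(z)=\int\frac{zx}{1-zx}\mu(\mathrm{d}x)$. If $\mu\in\mathcal{P}_+$, $\mu\ne\delta_0$, $\Psi_\mu$ has an inverse $\chi_\mu$ on $\Psi_\mu(i\mathbb{C}^+)$ with values in the left half-plane $i\mathbb{C}^+$; if $\mu\in\mathcal{P}_s$, $\mu\neq\delta_0$, $\Psi_\mu$ has an inverse $\chi_\mu:\Psi_\mu(H)\to H$, $H=\{z\in\mathbb{C}^-:|\mathrm{Re}\,z|<|\mathrm{Im}\,z|\}$. In both cases the $S$-transform is $S_\mu(z)=\chi_\mu(z)\frac{1+z}{z}$. For $\mu_1\in\mathcal{P}_+$ and $\mu_2\in\mathcal{P}_s$, $\mu_1\boxtimes\mu_2$ is the measure in $\mathcal{P}_s$ with $S_{\mu_1\boxtimes\mu_2}=S_{\mu_1}S_{\mu_2}$ on a common domain (and $\delta_0$ if one factor is $\delta_0$);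 equivalently, the spectral distribution of $X^{1/2}YX^{1/2}$ for free $X\ge0$ and $Y$ with distributions $\mu_1,\mu_2$. *)

theory Defs
  imports "HOL-Probability.Probability"
begin

definition arcsine_measure :: "real measure" where
  "arcsine_measure =
     density lborel (\<lambda>x. ennreal (indicator {-1<..<1} x / (pi * sqrt (1 - x\<^sup>2))))"

definition wigner_measure :: "real measure" where
  "wigner_measure =
     density lborel (\<lambda>x. ennreal (sqrt (4 - x\<^sup>2) / (2 * pi) * indicator {-2<..<2} x))"

definition prob_nonneg :: "real measure set" where
  "prob_nonneg = {\<mu>. prob_space \<mu> \<and> sets \<mu> = sets borel \<and> measure \<mu> {0..} = 1}"

definition prob_symmetric :: "real measure set" where
  "prob_symmetric = {\<mu>. prob_space \<mu> \<and> sets \<mu> = sets borel \<and> distr \<mu> borel uminus = \<mu>}"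

definition delta0 :: "real measure" where
  "delta0 = return borel 0"

definition Psi :: "real measure \<Rightarrow> complex \<Rightarrow> complex" where
  "Psi \<mu> z = (\<integral>x. z * complex_of_real x / (1 - z * complex_of_real x) \<partial>\<mu>)"

definition left_half_plane :: "complex set" where
  "left_half_plane = {z. Re z < 0}"

definition lower_sector :: "complex set" where
  "lower_sector = {z. Im z < 0 \<and> \<bar>Re z\<bar> < \<bar>Im z\<bar>}"

(* The set U is the region on which Psi is inverted: the left half-plane for measures on the
   nonnegative half-line, the lower sector for symmetric measures. In both cases, for a measure
   other than delta0, Psi is injective on U, so that inv_into is its inverse on Psi \<mu> ` U;
   the values of chi and S_transform outside this image carry no meaning. *)
definition chi :: "complex set \<Rightarrow> real measure \<Rightarrow> complex \<Rightarrow> complex" where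
  "chi U \<mu> = inv_into U (Psi \<mu>)"

definition S_transform :: "complex set \<Rightarrow> real measure \<Rightarrow> complex \<Rightarrow> complex" where
  "S_transform U \<mu> z = chi U \<mu> z * ((1 + z) / z)"

(* The relation "\<nu> is the free multiplicative convolution of \<mu>1 and \<mu>2", for \<mu>1 on the
   nonnegative half-line and \<mu>2 symmetric. It is a relation rather than an operator so that it
   has its intended meaning without appeal to the existence of the convolution. A common domain
   is a nonempty open connected subset of the three sets on which the S-transforms are defined;
   the identity on any such D determines Psi \<nu> on an open set and hence \<nu>. *)
definition is_free_mult_conv :: "real measure \<Rightarrow> real measure \<Rightarrow> real measure \<Rightarrow> bool" where
  "is_free_mult_conv \<mu>1 \<mu>2 \<nu> \<longleftrightarrow>
     \<mu>1 \<in> prob_nonneg \<and> \<mu>2 \<in> prob_symmetric \<and> \<nu> \<in> prob_symmetric \<and>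
     (if \<mu>1 = delta0 \<or> \<mu>2 = delta0 then \<nu> = delta0
      else \<nu> \<noteq> delta0 \<and>
        (\<exists>D. open D \<and> connected D \<and> D \<noteq> {} \<and>
             D \<subseteq> Psi \<mu>1 ` left_half_plane \<and>
             D \<subseteq> Psi \<mu>2 ` lower_sector \<and>
             D \<subseteq> Psi \<nu> ` lower_sector \<and>
             (\<forall>z\<in>D. S_transform lower_sector \<nu> z =
                     S_transform left_half_plane \<mu>1 z * S_transform lower_sector \<mu>2 z)))"

end

theory Submission
  imports Defs "HOL-Complex_Analysis.Conformal_Mappings"
begin

text \<open>
  Explicit integration on the negative imaginary axis and analytic continuation give algebraic
  equations for \<open>\<Psi>\<close> of the arcsine and the Wigner law, equivalent to \<open>S(w)\<^sup>2 = (w + 2)/w\<close> and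
  \<open>S(w)\<^sup>2 = 1/w\<close>. A free factor \<open>\<mu>\<close> must therefore satisfy \<open>S(w)\<^sup>2 = w + 2\<close>, i.e.
  \<open>z\<^sup>2 (1 + \<Psi>(z))\<^sup>2 = \<Psi>(z)\<^sup>2 (\<Psi>(z) + 2)\<close>, first for \<open>z = \<chi>(w)\<close> with \<open>w\<close> in the common domain. These
  \<open>z\<close> form an uncountable set, so the equation holds on the whole left half-plane, and
  injectivity of \<open>\<Psi>\<close> is not needed. On the negative axis \<open>S\<close> is positive and increasing according to
  \<open>S(w)\<^sup>2 = w + 2\<close>, whereas the \<open>S\<close>-transform of a measure on the half-line is decreasing there.
\<close>

section \<open>Differentiation of Psi under the integral sign\<close>

text \<open>Replacing w by z changes 1 - wx by (z - w)x, which is at most half of |1 - wx| when |z -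
  w| <= 1/(2d). The bound thus survives near w with 2d in place of d, which supplies the domination
  for difference quotients.\<close>

lemma AE_norm_kernel_le:
  fixes M :: "real measure" and w z :: complex
  assumes d: "d > 0" "AE x in M. \<bar>x\<bar> \<le> d * norm (1 - w * complex_of_real x)"
    and z: "norm (z - w) * (2 * d) \<le> 1"
  shows "AE x in M. 1 - z * complex_of_real x \<noteq> 0 \<and>
           norm (complex_of_real x / (1 - z * complex_of_real x)) \<le> 2 * d"
  using d(2)
proof eventually_elim
  case (elim x)
  let ?a = "1 - w * complex_of_real x" and ?b = "1 - z * complex_of_real x"
  have pos: "norm ?a > 0"
  proof (rule ccontr)
    assume "\<not> norm ?a > 0"
    with elim have "x = 0" by simp
    with \<open>\<not> norm ?a > 0\<close> show False by simp
  qed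
  have "norm ((z - w) * complex_of_real x) = norm (z - w) * \<bar>x\<bar>"
    by (simp add: norm_mult)
  also have "\<dots> \<le> norm (z - w) * (d * norm ?a)"
    using elim by (intro mult_left_mono) auto
  also have "\<dots> \<le> norm ?a / 2"
    using mult_right_mono[OF z, of "norm ?a / 2"] by (simp add: mult_ac)
  finally have "norm ?a / 2 \<le> norm ?a - norm ((z - w) * complex_of_real x)"
    by simp
  also have "\<dots> \<le> norm (?a - (z - w) * complex_of_real x)"
    by (rule norm_triangle_ineq2)
  also have "?a - (z - w) * complex_of_real x = ?b"
    by (simp add: algebra_simps)
  finally have half: "norm ?a / 2 \<le> norm ?b" .
  have "d * norm ?a \<le> d * (2 * norm ?b)"
    using half d(1) by (intro mult_left_mono) auto
  with elim have "\<bar>x\<bar> \<le> 2 * d * norm ?b" by linarith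
  then show ?case
    using half pos by (auto simp: norm_divide divide_simps)
qed

text \<open>The hypothesis bounds x/(1 - wx) almost everywhere. Both regions of inversion provide
  such a bound, so one dominated convergence argument serves them both.\<close>

lemma has_field_derivative_Psi:
  fixes w :: complex
  assumes "prob_space \<mu>" and sets[measurable_cong]: "sets \<mu> = sets borel"
    and bound: "AE x in \<mu>. \<bar>x\<bar> \<le> d * norm (1 - w * complex_of_real x)"
  shows "(Psi \<mu> has_field_derivative
            (\<integral>x. complex_of_real x / (1 - w * complex_of_real x)\<^sup>2 \<partial>\<mu>)) (at w)"
proof -
  interpret prob_space \<mu> by fact
  \<comment> \<open>The sign of d is unspecified, so a larger positive constant takes its
    place.\<close>
  define e where "e = \<bar>d\<bar> + 1"
  have e: "e > 0" by (simp add: e_def)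
  have bound': "AE x in \<mu>. \<bar>x\<bar> \<le> e * norm (1 - w * complex_of_real x)"
    using bound
  proof eventually_elim
    case (elim x)
    have "d * norm (1 - w * complex_of_real x) \<le> e * norm (1 - w * complex_of_real x)"
      by (intro mult_right_mono) (auto simp: e_def)
    with elim show ?case by linarith
  qed
  note kernel = AE_norm_kernel_le[OF e bound']
  have near: "\<forall>\<^sub>F z in at w. norm (z - w) * (2 * e) \<le> 1"
  proof -
    have "\<forall>\<^sub>F z in at w. dist z w < 1 / (2 * e)"
      unfolding eventually_at using e by (intro exI[of _ "1 / (2 * e)"]) simp
    then show ?thesis
      by eventually_elim (use e in \<open>auto simp: dist_norm field_simps\<close>)
  qed
  have w0: "norm (w - w) * (2 * e) \<le> 1" by simp
  show ?thesis
    unfolding has_field_derivative_iff tendsto_at_iff_sequentially comp_def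
  proof safe
    fix X :: "nat \<Rightarrow> complex"
    assume X: "\<forall>i. X i \<in> UNIV - {w}" "X \<longlonglongrightarrow> w"
    have lim: "filterlim X (at w) sequentially"
      using X by (auto simp: filterlim_at)
    obtain N where N: "\<And>n. n \<ge> N \<Longrightarrow> norm (X n - w) * (2 * e) \<le> 1"
      using eventually_compose_filterlim[OF near lim] by (auto simp: eventually_sequentially)
    \<comment> \<open>Dropping the first N terms makes the bound valid for every index, as dominated
      convergence demands.\<close>
    define Y where "Y n = X (n + N)" for n
    have Y: "norm (Y n - w) * (2 * e) \<le> 1" "Y n \<noteq> w" for n
      using N X by (auto simp: Y_def)
    have Ylim: "Y \<longlonglongrightarrow> w"
      unfolding Y_def using X(2) by (rule LIMSEQ_ignore_initial_segment)
    have int: "integrable \<mu> (\<lambda>x. z * complex_of_real x / (1 - z * complex_of_real x))"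
      if z: "norm (z - w) * (2 * e) \<le> 1" for z
    proof (rule integrable_const_bound)
      show "AE x in \<mu>. norm (z * complex_of_real x / (1 - z * complex_of_real x)) \<le> norm z * (2 * e)"
        using kernel[OF z]
      proof eventually_elim
        case (elim x)
        then show ?case
          using mult_left_mono[of "norm (complex_of_real x / (1 - z * complex_of_real x))" "2 * e" "norm z"]
          by (simp add: norm_mult norm_divide)
      qed
    qed measurable
    \<comment> \<open>The kernels at z and w differ by (z - w)x/((1 - zx)(1 - wx)), so z - w cancels
      and leaves two factors that are bounded separately.\<close>
    have quot: "(Psi \<mu> (Y n) - Psi \<mu> w) / (Y n - w) =
        (\<integral>x. complex_of_real x / (1 - Y n * complex_of_real x) * (1 / (1 - w * complex_of_real x)) \<partial>\<mu>)" for n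
    proof -
      have "(Psi \<mu> (Y n) - Psi \<mu> w) / (Y n - w) =
        (\<integral>x. (Y n * complex_of_real x / (1 - Y n * complex_of_real x) -
               w * complex_of_real x / (1 - w * complex_of_real x)) / (Y n - w) \<partial>\<mu>)"
        unfolding Psi_def by (simp add: Bochner_Integration.integral_diff[OF int[OF Y(1)] int[OF w0]])
      also have "\<dots> = (\<integral>x. complex_of_real x / (1 - Y n * complex_of_real x) * (1 / (1 - w * complex_of_real x)) \<partial>\<mu>)"
      proof (rule integral_cong_AE)
        show "AE x in \<mu>. (Y n * complex_of_real x / (1 - Y n * complex_of_real x) -
               w * complex_of_real x / (1 - w * complex_of_real x)) / (Y n - w) =
             complex_of_real x / (1 - Y n * complex_of_real x) * (1 / (1 - w * complex_of_real x))"
          using kernel[OF Y(1)[of n]] kernel[OF w0]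
        proof eventually_elim
          case (elim x)
          moreover have "Y n - w \<noteq> 0" using Y(2) by simp
          ultimately show ?case
            by (simp add: divide_simps) (simp add: algebra_simps)
        qed
      qed measurable
      finally show ?thesis .
    qed
    have "(\<lambda>n. \<integral>x. complex_of_real x / (1 - Y n * complex_of_real x) * (1 / (1 - w * complex_of_real x)) \<partial>\<mu>)
        \<longlonglongrightarrow> (\<integral>x. complex_of_real x / (1 - w * complex_of_real x) * (1 / (1 - w * complex_of_real x)) \<partial>\<mu>)"
    proof (rule integral_dominated_convergence[where w = "\<lambda>_. 2 * e * (1 + norm w * (2 * e))"])
      show "AE x in \<mu>. (\<lambda>n. complex_of_real x / (1 - Y n * complex_of_real x) * (1 / (1 - w * complex_of_real x)))
          \<longlonglongrightarrow> complex_of_real x / (1 - w * complex_of_real x) * (1 / (1 - w * complex_of_real x))"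
        using kernel[OF w0]
        by eventually_elim (intro tendsto_intros Ylim, auto)
      show "AE x in \<mu>. norm (complex_of_real x / (1 - Y n * complex_of_real x) * (1 / (1 - w * complex_of_real x)))
          \<le> 2 * e * (1 + norm w * (2 * e))" for n
        using kernel[OF Y(1)[of n]] kernel[OF w0]
      proof eventually_elim
        case (elim x)
        have "1 / (1 - w * complex_of_real x) = 1 + w * (complex_of_real x / (1 - w * complex_of_real x))"
          using elim by (simp add: divide_simps)
        also have "norm \<dots> \<le> 1 + norm w * (2 * e)"
        proof (rule norm_triangle_le)
          have "norm (w * (complex_of_real x / (1 - w * complex_of_real x))) \<le> norm w * (2 * e)"
            unfolding norm_mult[of w] using elim by (intro mult_left_mono) auto
          then show "norm (1::complex) + norm (w * (complex_of_real x / (1 - w * complex_of_real x)))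
              \<le> 1 + norm w * (2 * e)"
            by simp
        qed
        finally show ?case
          using elim e unfolding norm_mult by (intro mult_mono) auto
      qed
    qed (auto intro!: integrable_const)
    then have "(\<lambda>n. (Psi \<mu> (Y n) - Psi \<mu> w) / (Y n - w))
        \<longlonglongrightarrow> (\<integral>x. complex_of_real x / (1 - w * complex_of_real x)\<^sup>2 \<partial>\<mu>)"
      unfolding quot by (simp add: power2_eq_square)
    then show "(\<lambda>n. (Psi \<mu> (X n) - Psi \<mu> w) / (X n - w))
        \<longlonglongrightarrow> (\<integral>x. complex_of_real x / (1 - w * complex_of_real x)\<^sup>2 \<partial>\<mu>)"
      unfolding Y_def by (rule LIMSEQ_offset)
  qed
qed

text \<open>For real x the imaginary part of 1 - wx has modulus |Im w| |x|, so the constant 1/|Im w|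
  is admissible.\<close>

lemma holomorphic_Psi_lower_sector:
  assumes "prob_space \<mu>" "sets \<mu> = sets borel"
  shows "Psi \<mu> holomorphic_on lower_sector"
proof (rule holomorphic_onI)
  fix w assume w: "w \<in> lower_sector"
  have "AE x in \<mu>. \<bar>x\<bar> \<le> 1 / \<bar>Im w\<bar> * norm (1 - w * complex_of_real x)"
  proof (rule AE_I2)
    fix x
    have "\<bar>Im w\<bar> * \<bar>x\<bar> \<le> norm (1 - w * complex_of_real x)"
      using abs_Im_le_cmod[of "1 - w * complex_of_real x"] by (simp add: abs_mult)
    then show "\<bar>x\<bar> \<le> 1 / \<bar>Im w\<bar> * norm (1 - w * complex_of_real x)"
      using w by (simp add: lower_sector_def field_simps)
  qed
  from has_field_derivative_Psi[OF assms this]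
  show "Psi \<mu> field_differentiable at w within lower_sector"
    by (meson field_differentiable_def field_differentiable_at_within)
qed

lemma AE_prob_nonneg:
  assumes "\<mu> \<in> prob_nonneg"
  shows "AE x in \<mu>. 0 \<le> x"
proof -
  interpret prob_space \<mu> using assms by (simp add: prob_nonneg_def)
  show ?thesis
    using assms prob_eq_1[of "{0..}"] by (auto simp: prob_nonneg_def)
qed

text \<open>For x >= 0 and Re w < 0 the real part of 1 - wx is 1 + |Re w| x, so the constant 1/|Re
  w| is admissible. Here the support in the half-line enters.\<close>

lemma holomorphic_Psi_left_half_plane:
  assumes "\<mu> \<in> prob_nonneg"
  shows "Psi \<mu> holomorphic_on left_half_plane"
proof (rule holomorphic_onI)
  fix w assume w: "w \<in> left_half_plane"
  have "AE x in \<mu>. \<bar>x\<bar> \<le> 1 / \<bar>Re w\<bar> * norm (1 - w * complex_of_real x)"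
    using AE_prob_nonneg[OF assms]
  proof eventually_elim
    case (elim x)
    have "\<bar>Re w\<bar> * \<bar>x\<bar> \<le> norm (1 - w * complex_of_real x)"
      using complex_Re_le_cmod[of "1 - w * complex_of_real x"] elim w
      by (simp add: left_half_plane_def)
    then show "\<bar>x\<bar> \<le> 1 / \<bar>Re w\<bar> * norm (1 - w * complex_of_real x)"
      using w by (simp add: left_half_plane_def field_simps)
  qed
  with has_field_derivative_Psi[of \<mu>] assms
  show "Psi \<mu> field_differentiable at w within left_half_plane"
    unfolding prob_nonneg_def mem_Collect_eq
    by (meson field_differentiable_def field_differentiable_at_within)
qed

lemma open_lower_sector: "open lower_sector"
  unfolding lower_sector_def by (intro open_Collect_conj open_Collect_less continuous_intros)

lemma connected_lower_sector: "connected lower_sector"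
proof -
  have "lower_sector = {z. Im z + Re z < 0} \<inter> {z. Im z - Re z < 0}"
    by (auto simp: lower_sector_def)
  moreover have "convex {z. Im z + Re z < 0}" "convex {z. Im z - Re z < 0}"
    using convex_halfspace_lt[of "Complex 1 1" 0] convex_halfspace_lt[of "Complex (-1) 1" 0]
    by (simp_all add: inner_complex_def add.commute)
  ultimately show ?thesis
    by (metis convex_Int convex_connected)
qed

section \<open>Explicit integrals on the negative imaginary axis\<close>

text \<open>At z = -iy the kernel has an even real part and an odd imaginary part; symmetry kills
  the latter.\<close>

lemma Psi_symmetric_imag_axis:
  assumes "\<mu> \<in> prob_symmetric"
  shows "Psi \<mu> (- \<i> * complex_of_real y) =
           complex_of_real ((\<integral>x. 1 / (1 + y\<^sup>2 * x\<^sup>2) \<partial>\<mu>) - 1)"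
proof -
  interpret prob_space \<mu> using assms by (simp add: prob_symmetric_def)
  have sets[measurable_cong]: "sets \<mu> = sets borel" and sym: "distr \<mu> borel uminus = \<mu>"
    using assms by (auto simp: prob_symmetric_def)
  let ?z = "- \<i> * complex_of_real y"
  have pos: "1 + y\<^sup>2 * x\<^sup>2 > 0" for x :: real
    by (simp add: add_pos_nonneg)
  have ker: "?z * complex_of_real x / (1 - ?z * complex_of_real x) =
      Complex (1 / (1 + y\<^sup>2 * x\<^sup>2) - 1) (- (y * x / (1 + y\<^sup>2 * x\<^sup>2)))" for x
    using pos[of x]
    by (simp add: complex_eq_iff Re_divide Im_divide power_mult_distrib)
       (simp add: divide_simps power2_eq_square)
  have int1: "integrable \<mu> (\<lambda>x. 1 / (1 + y\<^sup>2 * x\<^sup>2))"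
    by (rule integrable_const_bound[of _ 1]) (use pos in \<open>auto simp: divide_simps\<close>)
  have int2: "integrable \<mu> (\<lambda>x. y * x / (1 + y\<^sup>2 * x\<^sup>2))"
  proof (rule integrable_const_bound[of _ 1])
    show "AE x in \<mu>. norm (y * x / (1 + y\<^sup>2 * x\<^sup>2)) \<le> 1"
    proof (rule AE_I2)
      fix x
      have "0 \<le> (1 - \<bar>y * x\<bar>)\<^sup>2" by simp
      then have "2 * \<bar>y * x\<bar> \<le> 1 + y\<^sup>2 * x\<^sup>2"
        by (simp add: power2_eq_square algebra_simps abs_mult)
      then show "norm (y * x / (1 + y\<^sup>2 * x\<^sup>2)) \<le> 1"
        using pos[of x] by (simp add: abs_mult)
    qed
  qed measurable
  have "(\<integral>x. y * x / (1 + y\<^sup>2 * x\<^sup>2) \<partial>\<mu>) = (\<integral>x. y * x / (1 + y\<^sup>2 * x\<^sup>2) \<partial>distr \<mu> borel uminus)"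
    by (simp add: sym)
  also have "\<dots> = (\<integral>x. - (y * x / (1 + y\<^sup>2 * x\<^sup>2)) \<partial>\<mu>)"
    by (subst integral_distr) auto
  finally have odd: "(\<integral>x. y * x / (1 + y\<^sup>2 * x\<^sup>2) \<partial>\<mu>) = 0"
    by simp
  have "Psi \<mu> ?z = (\<integral>x. complex_of_real (1 / (1 + y\<^sup>2 * x\<^sup>2) - 1) -
          \<i> * complex_of_real (y * x / (1 + y\<^sup>2 * x\<^sup>2)) \<partial>\<mu>)"
    unfolding Psi_def ker by (intro Bochner_Integration.integral_cong) (auto simp: complex_eq_iff)
  also have "\<dots> = complex_of_real (\<integral>x. 1 / (1 + y\<^sup>2 * x\<^sup>2) - 1 \<partial>\<mu>) -
          \<i> * complex_of_real (\<integral>x. y * x / (1 + y\<^sup>2 * x\<^sup>2) \<partial>\<mu>)"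
    using int1 int2
    by (subst Bochner_Integration.integral_diff) 
       (auto simp del: of_real_diff of_real_divide of_real_mult simp: integral_complex_of_real
          intro!: integrable_of_real integrable_mult_right)
  also have "\<dots> = complex_of_real ((\<integral>x. 1 / (1 + y\<^sup>2 * x\<^sup>2) \<partial>\<mu>) - 1)"
    unfolding odd using int1 by (simp add: prob_space)
  finally show ?thesis .
qed

text \<open>One integral serves both laws: r = 1 for the arcsine law, r = 2 for the Wigner law after
  a partial fraction decomposition.\<close>

lemma
  fixes r y :: real
  assumes r: "r > 0"
  shows set_integrable_arcsine_kernel:
      "set_integrable lborel {-r<..<r} (\<lambda>x. 1 / ((1 + y\<^sup>2 * x\<^sup>2) * sqrt (r\<^sup>2 - x\<^sup>2)))" (is ?int)
    and integral_arcsine_kernel: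
      "(LINT x:{-r<..<r}|lborel. 1 / ((1 + y\<^sup>2 * x\<^sup>2) * sqrt (r\<^sup>2 - x\<^sup>2))) = pi / sqrt (1 + r\<^sup>2 * y\<^sup>2)" (is ?val)
proof -
  define s where "s = sqrt (1 + r\<^sup>2 * y\<^sup>2)"
  have s2: "s\<^sup>2 = 1 + r\<^sup>2 * y\<^sup>2" by (simp add: s_def)
  have s: "s > 0" unfolding s_def by (simp add: add_pos_nonneg)
  \<comment> \<open>With x = r sin(theta) and v = tan(theta) = x / sqrt(r^2 - x^2) the integral
    becomes that of 1/(1 + s^2 v^2), whose antiderivative is arctan(s v)/s.\<close>
  define F where "F x = arctan (s * x / sqrt (r\<^sup>2 - x\<^sup>2)) / s" for x
  define f where "f x = 1 / ((1 + y\<^sup>2 * x\<^sup>2) * sqrt (r\<^sup>2 - x\<^sup>2))" for x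
  have rx: "r\<^sup>2 - x\<^sup>2 > 0" if "-r < x" "x < r" for x
    using that r power_strict_mono[of "\<bar>x\<bar>" r 2] by (simp add: abs_less_iff)
  have pos: "1 + y\<^sup>2 * x\<^sup>2 > 0" for x :: real
    by (simp add: add_pos_nonneg)
  have deriv: "(F has_real_derivative f x) (at x)" if x: "-r < x" "x < r" for x
  proof -
    define q where "q = sqrt (r\<^sup>2 - x\<^sup>2)"
    have q: "q > 0" "q\<^sup>2 = r\<^sup>2 - x\<^sup>2" using rx[OF x] by (auto simp: q_def)
    have dq: "((\<lambda>x. sqrt (r\<^sup>2 - x\<^sup>2)) has_real_derivative - (2 * x) / (2 * q)) (at x)"
    proof -
      have "((\<lambda>x. r\<^sup>2 - x\<^sup>2) has_real_derivative - (2 * x)) (at x)"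
        by (auto intro!: derivative_eq_intros)
      from DERIV_chain2[OF DERIV_real_sqrt[OF rx[OF x]] this]
      have "((\<lambda>x. sqrt (r\<^sup>2 - x\<^sup>2)) has_real_derivative inverse q / 2 * - (2 * x)) (at x)"
        by (simp only: q_def)
      also have "inverse q / 2 * - (2 * x) = - (2 * x) / (2 * q)"
        using q(1) by (simp add: field_simps)
      finally show ?thesis .
    qed
    have "((\<lambda>x. s * x / sqrt (r\<^sup>2 - x\<^sup>2)) has_real_derivative
        (s * q - s * x * (- (2 * x) / (2 * q))) / (q * q)) (at x)"
      by (rule DERIV_divide[OF DERIV_cmult_Id dq, folded q_def]) (use q(1) in simp)
    from DERIV_cdivide[OF DERIV_chain2[OF DERIV_arctan this], of s]
    have "(F has_real_derivative
        (inverse (1 + (s * x / q)\<^sup>2) * ((s * q - s * x * (- (2 * x) / (2 * q))) / (q * q)) / s)) (at x)"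
      unfolding F_def by (simp only: q_def)
    also have "(inverse (1 + (s * x / q)\<^sup>2) * ((s * q - s * x * (- (2 * x) / (2 * q))) / (q * q)) / s) = f x"
    proof -
      have sum: "q\<^sup>2 + s\<^sup>2 * x\<^sup>2 = r\<^sup>2 * (1 + y\<^sup>2 * x\<^sup>2)"
        by (simp add: q s2 algebra_simps)
      have num: "(s * q - s * x * (- (2 * x) / (2 * q))) / (q * q) = s * r\<^sup>2 / q ^ 3"
      proof -
        have "(s * q - s * x * (- (2 * x) / (2 * q))) / (q * q) = s * (q\<^sup>2 + x\<^sup>2) / q ^ 3"
          using q(1) by (simp add: field_simps power2_eq_square power3_eq_cube)
        then show ?thesis by (simp add: q)
      qed
      have denom: "1 + (s * x / q)\<^sup>2 = r\<^sup>2 * (1 + y\<^sup>2 * x\<^sup>2) / q\<^sup>2"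
        unfolding sum[symmetric] using q(1) by (simp add: field_simps)
      have "inverse (r\<^sup>2 * p / q\<^sup>2) * (s * r\<^sup>2 / q ^ 3) / s = 1 / (p * q)" if "p > 0" for p
        using q(1) s r that by (simp add: field_simps power2_eq_square power3_eq_cube)
      then show ?thesis
        unfolding num denom f_def q_def[symmetric] using pos[of x] by blast
    qed
    finally show ?thesis .
  qed
  have F_minus: "F (- x) = - F x" for x
    by (simp add: F_def arctan_minus)
  have limr: "(F \<longlongrightarrow> (pi / 2) / s) (at_left r)"
  proof -
    have "((\<lambda>x. sqrt (r\<^sup>2 - x\<^sup>2)) \<longlongrightarrow> sqrt (r\<^sup>2 - r\<^sup>2)) (at_left r)"
      by (intro tendsto_intros)
    moreover have in_interval: "\<forall>\<^sub>F x in at_left r. x \<in> {-r<..<r}"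
      using r by (intro eventually_at_leftI[of "-r"]) auto
    then have "\<forall>\<^sub>F x in at_left r. sqrt (r\<^sup>2 - x\<^sup>2) > 0"
      by eventually_elim (use rx in auto)
    ultimately have "LIM x at_left r. inverse (sqrt (r\<^sup>2 - x\<^sup>2)) :> at_top"
      by (intro filterlim_inverse_at_top) auto
    moreover have "((\<lambda>x. s * x) \<longlongrightarrow> s * r) (at_left r)"
      by (intro tendsto_intros)
    ultimately have "LIM x at_left r. s * x / sqrt (r\<^sup>2 - x\<^sup>2) :> at_top"
      unfolding divide_inverse using s r by (intro filterlim_tendsto_pos_mult_at_top[of _ "s * r"]) auto
    from filterlim_compose[OF tendsto_arctan_at_top this] show ?thesis
      unfolding F_def using s by (intro tendsto_divide tendsto_const) auto
  qed
  have liml: "(F \<longlongrightarrow> - ((pi / 2) / s)) (at_right (-r))"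
    using tendsto_minus[OF limr] by (simp add: at_right_minus filterlim_filtermap F_minus)
  have cont: "isCont f x" if "-r < x" "x < r" for x
    unfolding f_def using rx[OF that] pos[of x] by (auto intro!: continuous_intros)
  have f_nonneg: "f x \<ge> 0" if "-r < x" "x < r" for x
    unfolding f_def using rx[OF that] pos[of x] by simp
  \<comment> \<open>The integrand is unbounded at the endpoints; being nonnegative, it is integrable
    as soon as its antiderivative has finite limits there.\<close>
  have "set_integrable lborel (einterval (ereal (-r)) (ereal r)) f"
    "(LBINT x=ereal (-r)..ereal r. f x) = (pi / 2) / s - (- ((pi / 2) / s))"
    using r limr liml deriv cont f_nonneg
    by (intro interval_integral_FTC_nonneg[where F = F] AE_I2; simp add: ereal_tendsto_simps1)+
  then have "set_integrable lborel {-r<..<r} f" "(LINT x:{-r<..<r}|lborel. f x) = pi / s"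
    using r by (auto simp: interval_lebesgue_integral_def)
  then show ?int ?val
    unfolding f_def s_def by blast+
qed

lemma integral_arcsine_measure_even:
  "(\<integral>x. 1 / (1 + y\<^sup>2 * x\<^sup>2) \<partial>arcsine_measure) = 1 / sqrt (1 + y\<^sup>2)"
proof -
  have "(\<integral>x. 1 / (1 + y\<^sup>2 * x\<^sup>2) \<partial>arcsine_measure) =
      (\<integral>x. indicator {-1<..<1} x / (pi * sqrt (1 - x\<^sup>2)) * (1 / (1 + y\<^sup>2 * x\<^sup>2)) \<partial>lborel)"
    unfolding arcsine_measure_def
    by (subst integral_density)
       (auto simp: indicator_def abs_square_le_1 intro!: AE_I2)
  also have "\<dots> = (LINT x:{-1<..<1}|lborel. 1 / pi * (1 / ((1 + y\<^sup>2 * x\<^sup>2) * sqrt (1\<^sup>2 - x\<^sup>2))))"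
    unfolding set_lebesgue_integral_def
    by (intro Bochner_Integration.integral_cong) (auto simp: indicator_def)
  also have "\<dots> = 1 / sqrt (1 + y\<^sup>2)"
    by (subst set_integral_mult_right) (simp_all add: integral_arcsine_kernel[of 1 y, simplified])
  finally show ?thesis .
qed

text \<open>Since (4 - x^2)/(1 + y^2 x^2) = (4 + 1/y^2)/(1 + y^2 x^2) - 1/y^2, division by sqrt(4 -
  x^2) reduces the integral to the arcsine kernel at y and at 0.\<close>

lemma integral_wigner_measure_even:
  assumes "y \<noteq> 0"
  shows "(\<integral>x. 1 / (1 + y\<^sup>2 * x\<^sup>2) \<partial>wigner_measure) = (sqrt (1 + 4 * y\<^sup>2) - 1) / (2 * y\<^sup>2)"
proof -
  let ?k = "\<lambda>y x::real. 1 / ((1 + y\<^sup>2 * x\<^sup>2) * sqrt (2\<^sup>2 - x\<^sup>2))"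
  have pos: "1 + y\<^sup>2 * x\<^sup>2 > 0" for x :: real
    by (simp add: add_pos_nonneg)
  have sq: "x\<^sup>2 < 4" if "-2 < x" "x < 2" for x :: real
    using that abs_square_less_1[of "x / 2"] by (simp add: power_divide)
  have "(\<integral>x. 1 / (1 + y\<^sup>2 * x\<^sup>2) \<partial>wigner_measure) =
      (\<integral>x. sqrt (4 - x\<^sup>2) / (2 * pi) * indicator {-2<..<2} x * (1 / (1 + y\<^sup>2 * x\<^sup>2)) \<partial>lborel)"
    unfolding wigner_measure_def
    by (subst integral_density)
       (auto simp: indicator_def less_imp_le sq intro!: AE_I2)
  also have "\<dots> = (LINT x:{-2<..<2}|lborel.
      (4 + 1 / y\<^sup>2) / (2 * pi) * ?k y x - 1 / (2 * pi * y\<^sup>2) * ?k 0 x)"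
    unfolding set_lebesgue_integral_def
  proof (intro Bochner_Integration.integral_cong refl)
    fix x :: real
    show "sqrt (4 - x\<^sup>2) / (2 * pi) * indicator {-2<..<2} x * (1 / (1 + y\<^sup>2 * x\<^sup>2)) =
      indicator {-2<..<2} x *\<^sub>R ((4 + 1 / y\<^sup>2) / (2 * pi) * ?k y x - 1 / (2 * pi * y\<^sup>2) * ?k 0 x)"
    proof (cases "x \<in> {-2<..<2}")
      case True
      define q where "q = sqrt (4 - x\<^sup>2)"
      have q: "q > 0" "x\<^sup>2 = 4 - q\<^sup>2" using True sq[of x] by (auto simp: q_def)
      have "q / (2 * pi) * (1 / (1 + y\<^sup>2 * x\<^sup>2)) =
         (4 + 1 / y\<^sup>2) / (2 * pi) * (1 / ((1 + y\<^sup>2 * x\<^sup>2) * q)) - 1 / (2 * pi * y\<^sup>2) * (1 / q)"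
        using q(1) assms pos[of x] unfolding q(2)
        by (simp add: divide_simps) (simp add: algebra_simps power2_eq_square)
      with True show ?thesis by (simp add: q_def)
    qed auto
  qed
  also have "\<dots> = (4 + 1 / y\<^sup>2) / (2 * pi) * (pi / sqrt (1 + 2\<^sup>2 * y\<^sup>2)) - 1 / (2 * pi * y\<^sup>2) * pi"
  proof -
    have "(LINT x:{-2<..<2}|lborel. ?k 0 x) = pi"
      using integral_arcsine_kernel[of 2 0] by simp
    then show ?thesis
      using set_integrable_arcsine_kernel[of 2 y] set_integrable_arcsine_kernel[of 2 0]
        integral_arcsine_kernel[of 2 y]
      by (subst set_integral_diff(2)[OF set_integrable_mult_right set_integrable_mult_right])
         (simp_all only: set_integral_mult_right zero_less_numeral)
  qed
  also have "\<dots> = (sqrt (1 + 4 * y\<^sup>2) - 1) / (2 * y\<^sup>2)"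
  proof -
    define s where "s = sqrt (1 + 4 * y\<^sup>2)"
    have "s > 0" "1 + 4 * y\<^sup>2 = s\<^sup>2"
      by (auto simp: s_def add_pos_nonneg)
    then have "(4 + 1 / y\<^sup>2) / (2 * pi) * (pi / s) = s / (2 * y\<^sup>2)"
      using assms by (simp add: field_simps power2_eq_square)
    then show ?thesis using assms by (simp add: s_def diff_divide_distrib)
  qed
  finally show ?thesis .
qed

section \<open>Algebraic equations by analytic continuation\<close>

text \<open>The negative imaginary axis accumulates at the point -i of the connected open sector, so
  the identity theorem applies.\<close>

lemma lower_sector_identity:
  assumes "f holomorphic_on lower_sector"
    and "\<And>y::real. y > 0 \<Longrightarrow> f (- \<i> * complex_of_real y) = 0"
    and "z \<in> lower_sector"
  shows "f z = 0"
proof (rule analytic_continuation[OF assms(1) open_lower_sector connected_lower_sector])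
  let ?R = "(\<lambda>y. - \<i> * complex_of_real y) ` {0<..}"
  show "?R \<subseteq> lower_sector"
    by (auto simp: lower_sector_def)
  show "- \<i> * complex_of_real 1 \<in> lower_sector"
    by (simp add: lower_sector_def)
  have "(1::real) islimpt {0<..}"
    by (intro interior_limit_point) (simp add: interior_open)
  then show "- \<i> * complex_of_real 1 islimpt ?R"
    by (intro islimpt_isCont_image)
       (auto intro!: continuous_intros simp: eventually_at_filter)
qed (use assms in auto)

text \<open>On the axis 1 + Psi = 1/sqrt(1 + y^2) and 1 - z^2 = 1 + y^2. The squared form avoids
  choosing a branch of the root.\<close>

lemma Psi_arcsine_measure:
  assumes "arcsine_measure \<in> prob_symmetric" "z \<in> lower_sector"
  shows "(1 + Psi arcsine_measure z)\<^sup>2 * (1 - z\<^sup>2) = 1"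
proof -
  have "(1 + Psi arcsine_measure z)\<^sup>2 * (1 - z\<^sup>2) - 1 = 0"
  proof (rule lower_sector_identity[OF _ _ assms(2)])
    show "(\<lambda>z. (1 + Psi arcsine_measure z)\<^sup>2 * (1 - z\<^sup>2) - 1) holomorphic_on lower_sector"
      using assms(1) by (intro holomorphic_intros holomorphic_Psi_lower_sector)
        (auto simp: prob_symmetric_def)
    fix y :: real
    have "1 + y\<^sup>2 > 0" by (simp add: add_pos_nonneg)
    have "(1 + Psi arcsine_measure (- \<i> * complex_of_real y))\<^sup>2 * (1 - (- \<i> * complex_of_real y)\<^sup>2) =
        complex_of_real ((1 / sqrt (1 + y\<^sup>2))\<^sup>2 * (1 + y\<^sup>2))"
      unfolding Psi_symmetric_imag_axis[OF assms(1)] integral_arcsine_measure_even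
      by (simp add: power_mult_distrib)
    also have "(1 / sqrt (1 + y\<^sup>2))\<^sup>2 * (1 + y\<^sup>2) = 1"
      using \<open>1 + y\<^sup>2 > 0\<close> by (simp add: power_divide)
    finally show "(1 + Psi arcsine_measure (- \<i> * complex_of_real y))\<^sup>2 *
        (1 - (- \<i> * complex_of_real y)\<^sup>2) - 1 = 0"
      by simp
  qed
  then show ?thesis by simp
qed

lemma Psi_wigner_measure:
  assumes "wigner_measure \<in> prob_symmetric" "z \<in> lower_sector"
  shows "z\<^sup>2 * (1 + Psi wigner_measure z)\<^sup>2 = Psi wigner_measure z"
proof -
  have "z\<^sup>2 * (1 + Psi wigner_measure z)\<^sup>2 - Psi wigner_measure z = 0"
  proof (rule lower_sector_identity[OF _ _ assms(2)])
    show "(\<lambda>z. z\<^sup>2 * (1 + Psi wigner_measure z)\<^sup>2 - Psi wigner_measure z) holomorphic_on lower_sector"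
      using assms(1) by (intro holomorphic_intros holomorphic_Psi_lower_sector)
        (auto simp: prob_symmetric_def)
    fix y :: real assume y: "y > 0"
    define s where "s = sqrt (1 + 4 * y\<^sup>2)"
    have s2: "s\<^sup>2 = 1 + 4 * y\<^sup>2" by (simp add: s_def)
    define m where "m = (s - 1) / (2 * y\<^sup>2)"
    \<comment> \<open>\<open>m\<close> is the value of 1 + Psi at -iy, the positive root of y^2 m^2
      + m - 1 = 0, whose discriminant is s^2.\<close>
    have m: "- y\<^sup>2 * m\<^sup>2 = m - 1"
      using y s2 by (simp add: m_def field_simps power2_eq_square)
    have "(- \<i> * complex_of_real y)\<^sup>2 * (1 + Psi wigner_measure (- \<i> * complex_of_real y))\<^sup>2 -
        Psi wigner_measure (- \<i> * complex_of_real y) = complex_of_real (- y\<^sup>2 * m\<^sup>2 - (m - 1))"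
      using y unfolding Psi_symmetric_imag_axis[OF assms(1)]
      by (simp add: integral_wigner_measure_even power_mult_distrib m_def s_def)
    then show "(- \<i> * complex_of_real y)\<^sup>2 * (1 + Psi wigner_measure (- \<i> * complex_of_real y))\<^sup>2 -
        Psi wigner_measure (- \<i> * complex_of_real y) = 0"
      unfolding m by simp
  qed
  then show ?thesis by simp
qed

section \<open>The negative real axis and the contradiction there\<close>

lemma Psi_neg_real:
  "Psi \<mu> (- complex_of_real t) = complex_of_real (- (t * (\<integral>x. x / (1 + t * x) \<partial>\<mu>)))"
proof -
  have "Psi \<mu> (- complex_of_real t) = (\<integral>x. complex_of_real (- (t * (x / (1 + t * x)))) \<partial>\<mu>)"
    unfolding Psi_def by (intro Bochner_Integration.integral_cong) auto
  also have "\<dots> = complex_of_real (\<integral>x. - (t * (x / (1 + t * x))) \<partial>\<mu>)"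
    by (rule integral_complex_of_real)
  also have "(\<integral>x. - (t * (x / (1 + t * x))) \<partial>\<mu>) = - (t * (\<integral>x. x / (1 + t * x) \<partial>\<mu>))"
    unfolding Bochner_Integration.integral_minus Bochner_Integration.integral_mult_right_zero ..
  finally show ?thesis .
qed

lemma integrable_neg_real_kernel:
  assumes "\<mu> \<in> prob_nonneg" "t > 0"
  shows "integrable \<mu> (\<lambda>x. x / (1 + t * x))"
proof -
  interpret prob_space \<mu> using assms by (simp add: prob_nonneg_def)
  have [measurable_cong]: "sets \<mu> = sets borel" using assms by (simp add: prob_nonneg_def)
  show ?thesis
  proof (rule integrable_const_bound)
    show "AE x in \<mu>. norm (x / (1 + t * x)) \<le> 1 / t"
      using AE_prob_nonneg[OF assms(1)]
    proof eventually_elim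
      case (elim x)
      then have "1 + t * x > 0" using assms(2) by (simp add: add_pos_nonneg)
      then show ?case using elim assms(2) by (simp add: field_simps)
    qed
  qed measurable
qed

text \<open>The right-hand side is the tangent at b to the concave function u/(1 + hu); the gap is
  an explicit nonnegative multiple of (u - b)^2.\<close>

lemma concave_div_tangent:
  fixes b h u :: real
  assumes "h \<ge> 0" "b \<ge> 0" "u \<ge> 0"
  shows "u / (1 + h * u) \<le> b / (1 + h * b) + (u - b) / (1 + h * b)\<^sup>2"
proof -
  have pos: "1 + h * u > 0" "1 + h * b > 0"
    using assms by (auto simp: add_pos_nonneg)
  have "b / (1 + h * b) + (u - b) / (1 + h * b)\<^sup>2 - u / (1 + h * u) =
      h * (u - b)\<^sup>2 / ((1 + h * b)\<^sup>2 * (1 + h * u))"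
    using pos by (simp add: divide_simps) (simp add: algebra_simps power2_eq_square)
  also have "\<dots> \<ge> 0" using pos assms by simp
  finally show ?thesis by simp
qed

text \<open>
  With \<open>b(t) = \<integral>x/(1+tx)\<close> one has \<open>\<Psi>(-t) = -t b(t)\<close>, hence \<open>S(-t b(t)) = 1/b(t) - t\<close>; the
  inequality says that \<open>S\<close> is decreasing on the negative axis. It is Jensen's inequality: in the
  variable \<open>u = x/(1+sx)\<close> the function \<open>x/(1+tx)\<close> becomes the concave \<open>u/(1+(t-s)u)\<close>.
\<close>

lemma neg_real_kernel_jensen:
  assumes "\<mu> \<in> prob_nonneg" "0 < s" "s \<le> t"
  defines "b \<equiv> \<lambda>t. \<integral>x. x / (1 + t * x) \<partial>\<mu>"
  shows "b t * (1 + (t - s) * b s) \<le> b s"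
proof -
  interpret prob_space \<mu> using assms by (simp add: prob_nonneg_def)
  note AE = AE_prob_nonneg[OF assms(1)]
  define h where "h = t - s"
  have h: "h \<ge> 0" using assms by (simp add: h_def)
  have b0: "b s \<ge> 0"
    unfolding b_def by (rule integral_nonneg_AE) (use AE \<open>0 < s\<close> in \<open>auto elim!: eventually_mono\<close>)
  have int: "integrable \<mu> (\<lambda>x. x / (1 + s * x))" "integrable \<mu> (\<lambda>x. x / (1 + t * x))"
    using assms by (auto intro: integrable_neg_real_kernel)
  have pos: "1 + h * b s > 0" using h b0 by (simp add: add_pos_nonneg)
  have "(\<integral>x. x / (1 + t * x) \<partial>\<mu>) \<le>
      (\<integral>x. b s / (1 + h * b s) + (x / (1 + s * x) - b s) / (1 + h * b s)\<^sup>2 \<partial>\<mu>)"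
  proof (rule integral_mono_AE)
    show "AE x in \<mu>. x / (1 + t * x) \<le> b s / (1 + h * b s) + (x / (1 + s * x) - b s) / (1 + h * b s)\<^sup>2"
      using AE
    proof eventually_elim
      case (elim x)
      define u where "u = x / (1 + s * x)"
      have p: "1 + s * x > 0" "1 + t * x > 0"
        using assms elim by (auto simp: add_pos_nonneg)
      have "x / (1 + t * x) = u / (1 + h * u)"
      proof -
        have "1 + h * u = (1 + t * x) / (1 + s * x)"
          using p by (simp add: u_def h_def field_simps)
        then show ?thesis using p by (simp add: u_def)
      qed
      moreover have "u \<ge> 0" using p elim by (simp add: u_def)
      ultimately show ?case
        using concave_div_tangent[OF h b0, of u] unfolding u_def[symmetric] by simp
    qed
  qed (use int in auto)
  \<comment> \<open>The tangent was taken at the mean \<open>b s\<close>, so its linear term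
    integrates to zero.\<close>
  also have "\<dots> = b s / (1 + h * b s) + (b s - b s) / (1 + h * b s)\<^sup>2"
    using int by (simp add: prob_space b_def)
  finally have "b t \<le> b s / (1 + h * b s)"
    by (simp add: b_def)
  then show ?thesis
    using pos by (simp add: pos_le_divide_eq flip: h_def)
qed

text \<open>The integrand tx/(1 + tx) increases with t for x >= 0. This orders the arguments -t b(t)
  at which S is evaluated.\<close>

lemma neg_real_kernel_mono:
  assumes "\<mu> \<in> prob_nonneg" "0 < s" "s \<le> t"
  shows "s * (\<integral>x. x / (1 + s * x) \<partial>\<mu>) \<le> t * (\<integral>x. x / (1 + t * x) \<partial>\<mu>)"
proof -
  have "(\<integral>x. s * (x / (1 + s * x)) \<partial>\<mu>) \<le> (\<integral>x. t * (x / (1 + t * x)) \<partial>\<mu>)"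
  proof (rule integral_mono_AE)
    show "AE x in \<mu>. s * (x / (1 + s * x)) \<le> t * (x / (1 + t * x))"
      using AE_prob_nonneg[OF assms(1)]
    proof eventually_elim
      case (elim x)
      have "1 + s * x > 0" "1 + t * x > 0"
        using assms elim by (auto simp: add_pos_nonneg)
      then show ?case
        using mult_right_mono[OF assms(3) elim] by (simp add: field_simps)
    qed
  qed (intro integrable_mult_right integrable_neg_real_kernel; use assms in simp)+
  then show ?thesis
    by (simp only: Bochner_Integration.integral_mult_right_zero)
qed

text \<open>The points z = -1 and z = -2 suffice. The two opposite monotonicities of S force
  equality between them, and the equality case is inconsistent.\<close>

lemma Psi_left_half_plane_equation_impossible:
  assumes \<mu>: "\<mu> \<in> prob_nonneg"
    and eq: "\<And>z. z \<in> left_half_plane \<Longrightarrow> z\<^sup>2 * (1 + Psi \<mu> z)\<^sup>2 = (Psi \<mu> z)\<^sup>2 * (Psi \<mu> z + 2)"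
  shows False
proof -
  define b where "b t = (\<integral>x. x / (1 + t * x) \<partial>\<mu>)" for t
  have b0: "b t \<ge> 0" if "t > 0" for t
    unfolding b_def by (rule integral_nonneg_AE)
      (use AE_prob_nonneg[OF \<mu>] that in \<open>auto elim!: eventually_mono\<close>)
  have b_eq: "(1 - t * b t)\<^sup>2 = (b t)\<^sup>2 * (2 - t * b t)" if "t > 0" for t
  proof -
    have "complex_of_real (t\<^sup>2 * (1 - t * b t)\<^sup>2) = complex_of_real (t\<^sup>2 * ((b t)\<^sup>2 * (2 - t * b t)))"
      using eq[of "- complex_of_real t"] that
      unfolding Psi_neg_real b_def[symmetric]
      by (simp add: left_half_plane_def power_mult_distrib mult.assoc)
    then show ?thesis
      unfolding of_real_eq_iff using that by simp
  qed
  \<comment> \<open>If \<open>b t\<close> vanished, \<open>b_eq\<close> would read 1 = 0.\<close>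
  have bpos: "b t > 0" if "t > 0" for t
    using b0[OF that] b_eq[OF that] by (cases "b t = 0") auto
  define S where "S t = 1 / b t - t" for t
  \<comment> \<open>This is S(w)^2 = w + 2 at w = -t b(t).\<close>
  have S_eq: "(S t)\<^sup>2 = 2 - t * b t" if "t > 0" for t
  proof -
    have "S t = (1 - t * b t) / b t"
      using bpos[OF that] by (simp add: S_def field_simps)
    then show ?thesis
      using b_eq[OF that] bpos[OF that] by (simp add: power_divide)
  qed
  \<comment> \<open>The sign is needed to pass from \<open>S 1 \<le> S 2\<close> to the
    squares.\<close>
  have "S 1 \<ge> 0"
  proof -
    interpret prob_space \<mu> using \<mu> by (simp add: prob_nonneg_def)
    have "b 1 \<le> 1"
      unfolding b_def
    proof (rule integral_le_const[OF integrable_neg_real_kernel[OF \<mu>]])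
      show "AE x in \<mu>. x / (1 + 1 * x) \<le> 1"
        using AE_prob_nonneg[OF \<mu>] by eventually_elim simp
    qed simp
    then show ?thesis using bpos[of 1] by (simp add: S_def)
  qed
  moreover have "S 1 \<le> S 2"
    using neg_real_kernel_jensen[OF \<mu>, of 1 2, folded b_def] bpos[of 1] bpos[of 2]
    by (simp add: S_def field_simps)
  ultimately have "(S 1)\<^sup>2 \<le> (S 2)\<^sup>2"
    by (intro power_mono)
  then have "2 * b 2 \<le> b 1"
    using S_eq[of 1] S_eq[of 2] by simp
  moreover have "b 1 \<le> 2 * b 2"
    using neg_real_kernel_mono[OF \<mu>, of 1 2] by (simp add: b_def)
  ultimately have b1: "b 1 = 2 * b 2" by simp
  \<comment> \<open>Equality case: 1/b(2) - 2 = 2(1/b(1) - 1), while the squares agree. Hence S(1) =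
    0, which means b(1) = 1, whereas \<open>S_eq\<close> gives b(1) = 2.\<close>
  have "S 2 = 2 * S 1"
    using bpos[of 2] by (simp add: S_def b1 field_simps)
  moreover have "(S 1)\<^sup>2 = (S 2)\<^sup>2"
    using S_eq[of 1] S_eq[of 2] b1 by simp
  ultimately have "S 1 = 0" by simp
  with S_eq[of 1] have "b 1 = 2" by simp
  with \<open>S 1 = 0\<close> show False by (simp add: S_def)
qed

section \<open>From the common domain to the whole left half-plane\<close>

lemma fsigma_open:
  fixes S :: "'a::euclidean_space set"
  assumes "open S"
  shows "fsigma S"
  using open_Union_compact_subsets[OF assms] compact_imp_closed fsigma.intros by metis

text \<open>A measure with a density has no atom at 0. This rules out the degenerate branch of the
  convolution relation.\<close>

lemma arcsine_measure_neq_delta0: "arcsine_measure \<noteq> delta0"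
proof
  assume eq: "arcsine_measure = delta0"
  have "emeasure arcsine_measure {0} = 0"
    unfolding arcsine_measure_def
    by (subst emeasure_density) (auto simp: nn_integral_null_set AE_iff_null_sets intro: nn_integral_null_set)
  moreover have "emeasure delta0 {0} = 1"
    by (simp add: delta0_def)
  ultimately show False by (simp add: eq)
qed

theorem proposition18:
  "\<not> (\<exists>\<mu> \<in> prob_nonneg. is_free_mult_conv \<mu> wigner_measure arcsine_measure)"
proof
  assume "\<exists>\<mu> \<in> prob_nonneg. is_free_mult_conv \<mu> wigner_measure arcsine_measure"
  then obtain \<mu> where \<mu>: "\<mu> \<in> prob_nonneg"
    and conv: "is_free_mult_conv \<mu> wigner_measure arcsine_measure" by blast
  let ?U = left_half_plane and ?V = lower_sector
  \<comment> \<open>Both memberships are conjuncts of the assumed relation and are read off from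
    it.\<close>
  have sym: "wigner_measure \<in> prob_symmetric" "arcsine_measure \<in> prob_symmetric"
    using conv by (auto simp: is_free_mult_conv_def)
  have "\<exists>D. open D \<and> connected D \<and> D \<noteq> {} \<and> D \<subseteq> Psi \<mu> ` ?U \<and> D \<subseteq> Psi wigner_measure ` ?V \<and>
      D \<subseteq> Psi arcsine_measure ` ?V \<and>
      (\<forall>w\<in>D. S_transform ?V arcsine_measure w = S_transform ?U \<mu> w * S_transform ?V wigner_measure w)"
    using conv arcsine_measure_neq_delta0 unfolding is_free_mult_conv_def
    by (simp split: if_splits)
  then obtain D where D: "open D" "D \<noteq> {}" "D \<subseteq> Psi \<mu> ` ?U" "D \<subseteq> Psi wigner_measure ` ?V"
      "D \<subseteq> Psi arcsine_measure ` ?V"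
    and S: "\<forall>w\<in>D. S_transform ?V arcsine_measure w =
              S_transform ?U \<mu> w * S_transform ?V wigner_measure w"
    by blast
  let ?f = "\<lambda>z. z\<^sup>2 * (1 + Psi \<mu> z)\<^sup>2" and ?g = "\<lambda>z. (Psi \<mu> z)\<^sup>2 * (Psi \<mu> z + 2)"
  \<comment> \<open>The points 0 and -1 are removed so that w and 1 + w can be cancelled.\<close>
  have on_D: "\<exists>z \<in> ?U. w = Psi \<mu> z \<and> ?f z = ?g z" if w: "w \<in> D - {0, -1}" for w
  proof -
    have chi: "chi V \<nu> w \<in> V" "Psi \<nu> (chi V \<nu> w) = w" if "D \<subseteq> Psi \<nu> ` V" for V \<nu>
      using w that inv_into_into[of w "Psi \<nu>" V] f_inv_into_f[of w "Psi \<nu>" V]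
      unfolding chi_def by auto
    define a c z where "a = chi ?V arcsine_measure w" and "c = chi ?V wigner_measure w"
      and "z = chi ?U \<mu> w"
    have z: "z \<in> ?U" "Psi \<mu> z = w" using chi[OF D(3)] by (auto simp: z_def)
    have a: "(1 + w)\<^sup>2 * (1 - a\<^sup>2) = 1"
      using Psi_arcsine_measure[OF sym(2), of a] chi[OF D(5)] by (simp add: a_def)
    have c: "c\<^sup>2 * (1 + w)\<^sup>2 = w"
      using Psi_wigner_measure[OF sym(1), of c] chi[OF D(4)] by (simp add: c_def)
    have w0: "w \<noteq> 0" "1 + w \<noteq> 0" using w by (auto simp: add_eq_0_iff)
    have "a * ((1 + w) / w) = z * ((1 + w) / w) * (c * ((1 + w) / w))"
      using S w by (simp add: S_transform_def a_def c_def z_def)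
    then have "a * w = z * (c * (1 + w))"
    proof -
      have "a * w * ((1 + w) / w\<^sup>2) = z * (c * (1 + w)) * ((1 + w) / w\<^sup>2)"
        using \<open>a * _ = _\<close> w0 by (simp add: power2_eq_square)
      then show ?thesis using w0 by simp
    qed
    \<comment> \<open>After squaring, the Wigner equation eliminates c and leaves a^2 w = z^2; the
      arcsine equation then eliminates a.\<close>
    then have "a\<^sup>2 * w\<^sup>2 = z\<^sup>2 * (c\<^sup>2 * (1 + w)\<^sup>2)"
      by (metis power_mult_distrib)
    then have "a\<^sup>2 * w = z\<^sup>2"
      unfolding c using w0 by (simp add: power2_eq_square mult_ac)
    then have "z\<^sup>2 * (1 + w)\<^sup>2 = w * ((1 + w)\<^sup>2 - (1 + w)\<^sup>2 * (1 - a\<^sup>2))"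
      by (simp add: algebra_simps)
    also have "\<dots> = w\<^sup>2 * (w + 2)"
      unfolding a by (simp add: algebra_simps power2_eq_square)
    finally show ?thesis using z by auto
  qed
  have "uncountable D"
    using D(1,2) by (metis countable_subset ex_in_conv open_contains_ball uncountable_ball)
  then have "uncountable (D - {0, -1})"
    by (simp add: uncountable_minus_countable)
  \<comment> \<open>A countable set of solutions would have a countable image under Psi, too small
    to cover an open set minus two points.\<close>
  moreover have "D - {0, -1} \<subseteq> Psi \<mu> ` {z \<in> ?U. ?f z = ?g z}"
    using on_D by blast
  ultimately have "uncountable {z \<in> ?U. ?f z = ?g z}"
    by (meson countable_image countable_subset)
  moreover have "open ?U" "connected ?U"
    unfolding left_half_plane_def
    by (auto intro: open_halfspace_Re_lt convex_connected convex_halfspace_Re_lt)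
  ultimately have "?U \<subseteq> {z \<in> ?U. ?f z = ?g z}"
    by (intro holomorphic_countable_equal holomorphic_intros holomorphic_Psi_left_half_plane[OF \<mu>]
        fsigma_open)
  then show False
    by (intro Psi_left_half_plane_equation_impossible[OF \<mu>]) auto
qed

end
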